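(* Let $n\ge 2$ be an integer and $D=11\times(10^{2^n}-1)$. Then $D$ has at least $n+1$ (distinct) divisors that are Ball magic numbers.
   Context: Ball magic number: let $N\ge 2$ and let $x$ be a positive integer with exactly $N$ decimal digits, $x=a_{N-1}\dots a_0$ with $a_{N-1}\neq 0$, which is not a palindrome. Its reverse $x'$ is the integer with digit string $a_0a_1\dots a_{N-1}$ (leading zeros allowed). Let $y=|x-x'|$, written as an $N$-digit string $b_{N-1}\dots b_0$ (leading zeros allowed), and let $y'$ be the integer with digit string $b_0\dots b_{N-1}$. The nonzero integer $B=y+y'$ is a Ball magic number; a Ball magic number is any integer obtained this way from some such $x$. *)

theory Defs
  imports Complex_Main
begin

text \<open>Digit strings are lists of a prescribed length \<open>N\<close>, least significant digit first, padded
  with leading zeros (which then stand at the end of the list); \<open>x\<close> is the number denoted by its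
  string only if \<open>x < 10 ^ N\<close>.\<close>

definition digit_string :: "nat \<Rightarrow> nat \<Rightarrow> nat list" where
  "digit_string N x = map (\<lambda>i. x div 10 ^ i mod 10) [0..<N]"

definition string_value :: "nat list \<Rightarrow> nat" where
  "string_value ds = horner_sum (\<lambda>d. d) 10 ds"

definition reverse_number :: "nat \<Rightarrow> nat \<Rightarrow> nat" where
  "reverse_number N x = string_value (rev (digit_string N x))"

definition palindrome :: "nat \<Rightarrow> nat \<Rightarrow> bool" where
  "palindrome N x \<longleftrightarrow> rev (digit_string N x) = digit_string N x"

text \<open>Both reversals use the same length \<open>N\<close>, so leading zeros of \<open>y\<close> count. The bounds
  \<open>10 ^ (N - 1) \<le> x < 10 ^ N\<close> say that \<open>x\<close> has exactly \<open>N\<close> digits, the top one nonzero. As \<open>x\<close>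
  differs from its reverse, \<open>y\<close> and hence \<open>B\<close> are automatically nonzero.\<close>

definition ball_magic :: "nat \<Rightarrow> bool" where
  "ball_magic B \<longleftrightarrow>
    (\<exists>N x y. 2 \<le> N \<and> 10 ^ (N - 1) \<le> x \<and> x < 10 ^ N \<and> \<not> palindrome N x \<and>
      int y = \<bar>int x - int (reverse_number N x)\<bar> \<and>
      B = y + reverse_number N y)"

end

theory Submission
  imports Defs
begin

text \<open>For \<open>m \<ge> 1\<close> the \<open>(m + 1)\<close>-digit number \<open>x = 20\<dots>01\<close> has reverse \<open>10\<dots>02\<close>, so
  \<open>y = 10 ^ m - 1 = 09\<dots>9\<close>, whose reverse is \<open>9\<dots>90 = 10 * y\<close>, and \<open>B = 11 * (10 ^ m - 1)\<close>. Taking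
  \<open>m = 2 ^ k\<close> with \<open>k \<le> n\<close> gives \<open>n + 1\<close> distinct divisors of \<open>11 * (10 ^ (2 ^ n) - 1)\<close>.\<close>

lemma digit_string_Suc:
  "digit_string (Suc N) x = x mod 10 # digit_string N (x div 10)"
  unfolding digit_string_def map_upt_Suc by (simp add: div_mult2_eq)

lemma string_value_Nil [simp]: "string_value [] = 0"
  by (simp add: string_value_def)

lemma string_value_Cons [simp]: "string_value (d # ds) = d + 10 * string_value ds"
  by (simp add: string_value_def)

text \<open>Digits below 10 cause no carry, so \<open>mod 10\<close> and \<open>div 10\<close>
  recover head and tail. A number given by an explicit digit list can thus be reversed by reversing
  the list.\<close>

lemma digit_string_string_value:
  "\<forall>d \<in> set ds. d < 10 \<Longrightarrow> digit_string (length ds) (string_value ds) = ds"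
proof (induction ds)
  case Nil
  then show ?case by (simp add: digit_string_def)
next
  case (Cons d ds)
  then show ?case by (simp add: digit_string_Suc)
qed

lemma string_value_append:
  "string_value (ds @ es) = string_value ds + 10 ^ length ds * string_value es"
  by (induction ds) (simp_all add: algebra_simps)

lemma string_value_replicate_zero: "string_value (replicate m 0) = 0"
  by (induction m) simp_all

lemma string_value_replicate_nine: "string_value (replicate m 9) = 10 ^ m - 1"
proof (induction m)
  case (Suc m)
  \<comment> \<open>Subtraction on \<open>nat\<close> truncates; the bound gives
    \<open>9 + 10 * (10 ^ m - 1) = 10 ^ Suc m - 1\<close>.\<close>
  have "(1::nat) \<le> 10 ^ m" by simp
  with Suc show ?case
    by (simp only: replicate_Suc string_value_Cons power_Suc)
qed simp

lemma reverse_number_string_value: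
  "\<forall>d \<in> set ds. d < 10 \<Longrightarrow> reverse_number (length ds) (string_value ds) = string_value (rev ds)"
  by (simp add: reverse_number_def digit_string_string_value)

lemma ball_magic_eleven_times:
  assumes "m \<ge> 1"
  shows "ball_magic (11 * (10 ^ m - 1))"
proof -
  obtain k where m: "m = Suc k" using assms by (cases m) auto
  define xs where "xs = 1 # replicate k 0 @ [2::nat]"
  \<comment> \<open>The final \<open>0\<close> is the leading zero that pads y to the length of x;
    under reversal it yields the factor 10.\<close>
  define ys where "ys = replicate m 9 @ [0::nat]"
  have xs: "length xs = Suc m" "\<forall>d \<in> set xs. d < 10"
    and xval: "string_value xs = 2 * 10 ^ m + 1"
    and xrev: "string_value (rev xs) = 10 ^ m + 2"
    by (auto simp: xs_def m string_value_append string_value_replicate_zero)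
  have ys: "length ys = Suc m" "\<forall>d \<in> set ys. d < 10"
    and yval: "string_value ys = 10 ^ m - 1"
    and yrev: "string_value (rev ys) = 10 * (10 ^ m - 1)"
    by (auto simp: ys_def string_value_append string_value_replicate_nine)
  have "\<not> palindrome (Suc m) (string_value xs)"
    using digit_string_string_value[OF xs(2)] xs(1) by (simp add: palindrome_def xs_def)
  moreover have "reverse_number (Suc m) (string_value xs) = 10 ^ m + 2"
    using reverse_number_string_value[OF xs(2)] xs(1) xrev by simp
  moreover have "reverse_number (Suc m) (string_value ys) = 10 * (10 ^ m - 1)"
    using reverse_number_string_value[OF ys(2)] ys(1) yrev by simp
  \<comment> \<open>Writing the power as \<open>Suc t\<close> removes the truncated subtraction and
    leaves linear arithmetic.\<close>
  moreover obtain t where "(10::nat) ^ m = Suc t"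
    using not0_implies_Suc[of "10 ^ m"] by auto
  ultimately have "2 \<le> Suc m \<and> 10 ^ (Suc m - 1) \<le> string_value xs \<and>
      string_value xs < 10 ^ Suc m \<and> \<not> palindrome (Suc m) (string_value xs) \<and>
      int (string_value ys) =
        \<bar>int (string_value xs) - int (reverse_number (Suc m) (string_value xs))\<bar> \<and>
      11 * (10 ^ m - 1) = string_value ys + reverse_number (Suc m) (string_value ys)"
    using assms by (simp add: xval yval)
  then show ?thesis
    unfolding ball_magic_def by blast
qed

lemma power_minus_one_dvd:
  fixes a :: nat
  assumes "a > 0" "k dvd m"
  shows "a ^ k - 1 dvd a ^ m - 1"
proof -
  obtain j where m: "m = k * j" using assms(2) by blast
  \<comment> \<open>The cofactor is a geometric sum in \<open>a ^ k\<close>.\<close>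
  have "int (a ^ k) - 1 dvd int (a ^ k) ^ j - 1"
    by (simp add: power_diff_1_eq)
  then have "int (a ^ k - 1) dvd int (a ^ m - 1)"
    using assms(1) by (simp add: m power_mult of_nat_diff)
  then show ?thesis by (simp only: int_dvd_int_iff)
qed

theorem theorem22:
  fixes n :: nat
  assumes "n \<ge> 2"
  shows "card {B. ball_magic B \<and> B dvd 11 * (10 ^ (2 ^ n) - 1)} \<ge> n + 1"
proof -
  define f :: "nat \<Rightarrow> nat" where "f k = 11 * (10 ^ (2 ^ k) - 1)" for k
  let ?S = "{B. ball_magic B \<and> B dvd 11 * (10 ^ (2 ^ n) - 1)}"
  \<comment> \<open>This makes the multiple of 11 nonzero, hence its set of divisors finite; an
    infinite set would have \<open>card\<close> 0.\<close>
  have "(10::nat) ^ 1 \<le> 10 ^ (2 ^ n)" by (rule power_increasing) simp_all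
  then have "finite ?S"
    by (intro finite_subset[OF _ finite_divisors_nat[of "11 * (10 ^ (2 ^ n) - 1)"]]) auto
  moreover have "f ` {..n} \<subseteq> ?S"
    unfolding f_def
    by (intro image_subsetI CollectI conjI ball_magic_eleven_times mult_dvd_mono
        power_minus_one_dvd le_imp_power_dvd) simp_all
  \<comment> \<open>Both powers are at least 1, so \<open>eq_diff_iff\<close> cancels the subtracted
    1.\<close>
  moreover have "inj_on f {..n}"
    by (auto simp: inj_on_def f_def eq_diff_iff)
  ultimately show ?thesis
    using card_mono[of ?S "f ` {..n}"] by (simp add: card_image)
qed

end
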